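(* For compensated summation of real numbers $x_1,\ldots,x_n$, define $\mu_k\equiv\eta_k-\delta_k$ for $2\le k\le n-1$ and $\mu_n\equiv\eta_n$. Then the error $e_n=\hat{s}_n-s_n$ satisfies, to second order, $$e_n=s_n\sigma_n+(1+\sigma_n)\sum_{k=2}^n x_k\mu_k-\sum_{k=2}^{n-1}s_k\sigma_k(\mu_{k+1}+\delta_k+\beta_k)-\sum_{k=2}^{n-1}x_k\delta_k(\mu_{k+1}+\beta_k+\eta_k)+\mathcal{O}(u^3),$$ with the bound $$|\hat{s}_n-s_n|\le(3u+4nu^2)\sum_{k=1}^n|x_k|+\mathcal{O}(u^3).$$
   Context: Let $x_1,\ldots,x_n$ be real numbers ($n\ge 2$), $s_k=\sum_{j=1}^k x_j$ the exact partial sums, and $0<u<1$ the unit roundoff. The finite precision model of compensated (Kahan) summation is $$\hat{s}_1=s_1=x_1,\qquad\hat{c}_1=0,$$ and for $2\le k\le n$ $$\hat{y}_k=(x_k-\hat{c}_{k-1})(1+\eta_k),\quad \hat{s}_k=(\hat{s}_{k-1}+\hat{y}_k)(1+\sigma_k),\quad \hat{c}_k=\bigl((\hat{s}_k-\hat{s}_{k-1})(1+\delta_k)-\hat{y}_k\bigr)(1+\beta_k),$$ with $\eta_2=0$ and $|\eta_k|,|\sigma_k|,|\delta_k|,|\beta_k|\le u$. The notation $\mathcal{O}(u^3)$ is as $u\to0$, with constant depending only on $n$ and $x_1,\ldots,x_n$, uniformly over all roundoffs bounded by $u$. *)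

theory Defs
  imports Complex_Main
begin

definition partial_sum :: "(nat \<Rightarrow> real) \<Rightarrow> nat \<Rightarrow> real" where
  "partial_sum x k = (\<Sum>j=1..k. x j)"

text \<open>
  The variables \<open>y\<close>, \<open>s\<close>, \<open>c\<close> are the computed (hatted) quantities.  All sequences are
  1-based; only the values at the indices \<open>1, \<dots>, n\<close> (from \<open>2\<close> on for \<open>y\<close> and the
  roundoffs) are constrained.
\<close>

definition compensated_summation ::
  "real \<Rightarrow> nat \<Rightarrow> (nat \<Rightarrow> real) \<Rightarrow>
   (nat \<Rightarrow> real) \<Rightarrow> (nat \<Rightarrow> real) \<Rightarrow> (nat \<Rightarrow> real) \<Rightarrow> (nat \<Rightarrow> real) \<Rightarrow>
   (nat \<Rightarrow> real) \<Rightarrow> (nat \<Rightarrow> real) \<Rightarrow> (nat \<Rightarrow> real) \<Rightarrow> bool" where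
  "compensated_summation u n x \<eta> \<sigma> \<delta> \<beta> y s c \<longleftrightarrow>
     0 < u \<and> u < 1 \<and>
     s 1 = x 1 \<and> c 1 = 0 \<and> \<eta> 2 = 0 \<and>
     (\<forall>k\<in>{2..n}.
        \<bar>\<eta> k\<bar> \<le> u \<and> \<bar>\<sigma> k\<bar> \<le> u \<and> \<bar>\<delta> k\<bar> \<le> u \<and> \<bar>\<beta> k\<bar> \<le> u \<and>
        y k = (x k - c (k - 1)) * (1 + \<eta> k) \<and>
        s k = (s (k - 1) + y k) * (1 + \<sigma> k) \<and>
        c k = ((s k - s (k - 1)) * (1 + \<delta> k) - y k) * (1 + \<beta> k))"

definition mu :: "nat \<Rightarrow> (nat \<Rightarrow> real) \<Rightarrow> (nat \<Rightarrow> real) \<Rightarrow> nat \<Rightarrow> real" where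
  "mu n \<eta> \<delta> k = (if k = n then \<eta> n else \<eta> k - \<delta> k)"

end

theory Submission
  imports Defs "HOL-Library.Landau_Symbols"
begin

text \<open>
  The proof follows the quantity \<open>s k - c k\<close>, the computed sum with its computed correction
  subtracted, and its distance from the exact partial sum, called the \<^emph>\<open>defect\<close> below.
  The correction \<open>c k\<close> cancels the rounding error \<open>\<sigma>\<^sub>k\<close> of the main addition to first
  order, so that one step changes the defect only by
  \<open>(\<eta>\<^sub>k - \<delta>\<^sub>k) x\<^sub>k\<close> plus second-order terms.  Hence the first-order part of the defect is a weighted
  sum of the single \<open>x\<^sub>k\<close>, free of partial sums.
  The last addition is never corrected: it contributes the factor \<open>1 + \<sigma>\<^sub>n\<close>, and \<open>\<mu>\<^sub>n\<close> is \<open>\<eta>\<^sub>n\<close>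
  because \<open>\<delta>\<^sub>n\<close> enters only \<open>c n\<close>, which is computed after \<open>s n\<close>.

  To find the second-order terms, the correction is needed to first order only:
  \<open>c k = \<sigma>\<^sub>k s\<^sub>k + \<delta>\<^sub>k x\<^sub>k + \<O>(u\<^sup>2)\<close> with the exact partial sum \<open>s\<^sub>k\<close>
  (lemma \<open>correction_second_order\<close>).  Inserting this in the exact recurrence of the defect
  gives its increments up to \<open>\<O>(u\<^sup>3)\<close> (\<open>defect_increment_third_order\<close>); summing them
  and reindexing the contributions of \<open>c (k - 1)\<close> gives the expansion.

  Every \<open>\<O>\<close> has to be uniform over all roundoffs bounded by \<open>u\<close>.  This is obtained by doing
  Landau calculus along a filter on whole runs of the algorithm: the filter of all
  admissible runs whose unit roundoff tends to \<open>0\<close>.  A constant valid eventually along that filter is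
  by construction independent of the individual roundoffs.

  The bound follows from the expansion term by term: with \<open>S = \<Sum>\<bar>x\<^sub>k\<bar>\<close> the terms are at most
  \<open>u S\<close>, \<open>(1 + u) 2 u S\<close>, \<open>(n - 2) 4 u\<^sup>2 S\<close> and \<open>4 u\<^sup>2 S\<close>, with sum
  \<open>(3 u + (4 n - 2) u\<^sup>2) S\<close>.
\<close>

section \<open>Exact recurrences\<close>

definition defect :: "(nat \<Rightarrow> real) \<Rightarrow> (nat \<Rightarrow> real) \<Rightarrow> (nat \<Rightarrow> real) \<Rightarrow> nat \<Rightarrow> real" where
  "defect x s c k = s k - c k - partial_sum x k"

text \<open>
  The first-order part of the correction.  The value \<open>0\<close> at \<open>k = 1\<close> reflects \<open>c 1 = 0\<close>; there
  are no roundoffs with index \<open>1\<close>.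
\<close>

definition leading_correction ::
  "(nat \<Rightarrow> real) \<Rightarrow> (nat \<Rightarrow> real) \<Rightarrow> (nat \<Rightarrow> real) \<Rightarrow> nat \<Rightarrow> real" where
  "leading_correction x \<sigma> \<delta> k = (if k < 2 then 0 else \<sigma> k * partial_sum x k + \<delta> k * x k)"

definition leading_increment ::
  "(nat \<Rightarrow> real) \<Rightarrow> (nat \<Rightarrow> real) \<Rightarrow> (nat \<Rightarrow> real) \<Rightarrow> (nat \<Rightarrow> real) \<Rightarrow> (nat \<Rightarrow> real) \<Rightarrow> nat \<Rightarrow> real" where
  "leading_increment x \<eta> \<sigma> \<delta> \<beta> k =
     (x k - leading_correction x \<sigma> \<delta> (k - 1)) * (\<eta> k - \<delta> k)
     - \<sigma> k * partial_sum x k * (\<delta> k + \<beta> k) - \<delta> k * x k * (\<eta> k + \<beta> k)"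

lemma partial_sum_step:
  assumes "k \<ge> 2"
  shows "partial_sum x k = partial_sum x (k - 1) + x k"
proof -
  from assms obtain m where "k = Suc m" "m \<ge> 1" by (cases k) auto
  then show ?thesis by (simp add: partial_sum_def)
qed

context
  fixes u n x \<eta> \<sigma> \<delta> \<beta> y s c k
  assumes run: "compensated_summation u n x \<eta> \<sigma> \<delta> \<beta> y s c" and k: "k \<in> {2..n}"
begin

lemma run_step:
  "y k = (x k - c (k - 1)) * (1 + \<eta> k)"
  "s k = (s (k - 1) + y k) * (1 + \<sigma> k)"
  "c k = ((s k - s (k - 1)) * (1 + \<delta> k) - y k) * (1 + \<beta> k)"
  using run k unfolding compensated_summation_def by blast+

lemma run_roundoffs: "\<bar>\<eta> k\<bar> \<le> u" "\<bar>\<sigma> k\<bar> \<le> u" "\<bar>\<delta> k\<bar> \<le> u" "\<bar>\<beta> k\<bar> \<le> u"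
  using run k unfolding compensated_summation_def by blast+

text \<open>
  Before the rounding \<open>\<sigma>\<^sub>k\<close>, the old defect survives, and only the
  rounding of \<open>y k\<close> is added to it.
\<close>

lemma pre_rounding_sum:
  "s (k - 1) + y k = partial_sum x k + defect x s c (k - 1) + \<eta> k * (x k - c (k - 1))"
  using k by (simp add: run_step(1) defect_def partial_sum_step algebra_simps)

lemma final_sum:
  "s k = (partial_sum x k + defect x s c (k - 1) + \<eta> k * (x k - c (k - 1))) * (1 + \<sigma> k)"
  using run_step(2) pre_rounding_sum by simp

text \<open>
  The difference \<open>s k - s (k - 1)\<close> recovers \<open>y k\<close> together with the rounding error of the
  addition; subtracting \<open>y k\<close> cancels everything except for terms carrying a roundoff.
\<close>

lemma correction_eq:
  "c k = (\<sigma> k * (s (k - 1) + y k) * (1 + \<delta> k) + \<delta> k * y k) * (1 + \<beta> k)"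
proof -
  have "s k - s (k - 1) = y k + \<sigma> k * (s (k - 1) + y k)"
    using run_step(2) by (simp add: algebra_simps)
  then show ?thesis
    using run_step(3) by (simp add: algebra_simps)
qed

text \<open>The terms linear in \<open>\<sigma> k\<close> cancel between \<open>s k\<close> and \<open>c k\<close>.\<close>

lemma defect_step:
  "defect x s c k = defect x s c (k - 1) + \<eta> k * (x k - c (k - 1))
     - \<sigma> k * (s (k - 1) + y k) * (\<delta> k + \<beta> k + \<delta> k * \<beta> k) - \<delta> k * y k * (1 + \<beta> k)"
proof -
  have "defect x s c k = (s (k - 1) + y k) * (1 + \<sigma> k) - c k - partial_sum x k"
    using run_step(2) by (simp add: defect_def)
  also have "\<dots> = (s (k - 1) + y k - partial_sum x k)
     - \<sigma> k * (s (k - 1) + y k) * (\<delta> k + \<beta> k + \<delta> k * \<beta> k) - \<delta> k * y k * (1 + \<beta> k)"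
    unfolding correction_eq by (simp add: algebra_simps)
  also have "s (k - 1) + y k - partial_sum x k
      = defect x s c (k - 1) + \<eta> k * (x k - c (k - 1))"
    using pre_rounding_sum by simp
  finally show ?thesis by simp
qed

text \<open>
  The next two identities write the remainders as sums of products whose orders can be read off
  factor by factor once \<open>c (k - 1)\<close> and the defect at \<open>k - 1\<close> are known to be \<open>\<O>(u)\<close>.  Every
  product in the first identity then has order at least two; with this result at \<open>k - 1\<close>, every
  product in the second has order at least three.
\<close>

lemma correction_remainder:
  "c k - leading_correction x \<sigma> \<delta> k =
     \<sigma> k * (s (k - 1) + y k - partial_sum x k)
     + \<sigma> k * (s (k - 1) + y k) * (\<delta> k + \<beta> k + \<delta> k * \<beta> k)
     + \<delta> k * ((x k - c (k - 1)) * \<eta> k - c (k - 1)) + \<delta> k * y k * \<beta> k"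
proof -
  have "leading_correction x \<sigma> \<delta> k = \<sigma> k * partial_sum x k + \<delta> k * x k"
    using k by (simp add: leading_correction_def)
  moreover have y: "(x k - c (k - 1)) * \<eta> k - c (k - 1) = y k - x k"
    using run_step(1) by (simp add: algebra_simps)
  ultimately show ?thesis
    unfolding correction_eq y by (simp add: algebra_simps)
qed

lemma defect_increment_remainder:
  "defect x s c k - defect x s c (k - 1) - leading_increment x \<eta> \<sigma> \<delta> \<beta> k =
     \<delta> k * c (k - 1) * (\<eta> k + \<beta> k)
     - (\<eta> k - \<delta> k) * (c (k - 1) - leading_correction x \<sigma> \<delta> (k - 1))
     - \<delta> k * (x k - c (k - 1)) * (\<eta> k * \<beta> k)
     - \<sigma> k * (s (k - 1) + y k - partial_sum x k) * (\<delta> k + \<beta> k)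
     - \<sigma> k * (s (k - 1) + y k) * (\<delta> k * \<beta> k)"
  unfolding defect_step leading_increment_def run_step(1) by (simp add: algebra_simps)

end

section \<open>Orders of magnitude along a family of runs\<close>

text \<open>
  The data of a run are functions of an index \<open>r\<close>, so that a bound along \<open>F\<close> is uniform in the
  roundoffs.  Only \<open>x\<close> and \<open>n\<close> are common to the whole family, and these are what the constants
  may depend on.
\<close>

locale compensated_summation_family =
  fixes F :: "'r filter" and n :: nat and x :: "nat \<Rightarrow> real"
    and u :: "'r \<Rightarrow> real" and \<eta> \<sigma> \<delta> \<beta> y s c :: "'r \<Rightarrow> nat \<Rightarrow> real"
  assumes runs: "\<forall>\<^sub>F r in F. compensated_summation (u r) n x (\<eta> r) (\<sigma> r) (\<delta> r) (\<beta> r) (y r) (s r) (c r)"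
begin

abbreviation ord :: "nat \<Rightarrow> ('r \<Rightarrow> real) set" where
  "ord i \<equiv> O[F](\<lambda>r. u r ^ i)"

lemma ord_mult: "f \<in> ord i \<Longrightarrow> g \<in> ord j \<Longrightarrow> (\<lambda>r. f r * g r) \<in> ord (i + j)"
  unfolding power_add by (rule landau_o.big.mult)

lemma ord_const: "(\<lambda>r. a) \<in> ord 0"
  by simp

lemma ord_mono:
  assumes f: "f \<in> ord i" and "j \<le> i"
  shows "f \<in> ord j"
proof -
  have "(\<lambda>r. u r ^ i) \<in> ord j"
  proof (rule bigoI[where c = 1])
    show "\<forall>\<^sub>F r in F. norm (u r ^ i) \<le> 1 * norm (u r ^ j)"
      using runs
    proof eventually_elim
      case (elim r)
      then have "0 < u r" "u r < 1" by (auto simp: compensated_summation_def)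
      with \<open>j \<le> i\<close> show ?case by (simp add: power_abs power_decreasing)
    qed
  qed
  with f show ?thesis by (rule landau_o.big_trans)
qed

lemma ord_transfer:
  assumes g: "g \<in> ord j" and ij: "i \<le> j"
    and eq: "\<And>r. compensated_summation (u r) n x (\<eta> r) (\<sigma> r) (\<delta> r) (\<beta> r) (y r) (s r) (c r) \<Longrightarrow> f r = g r"
  shows "f \<in> ord i"
proof -
  have "\<forall>\<^sub>F r in F. f r = g r"
    using runs by (rule eventually_mono) (rule eq)
  with ord_mono[OF g ij] show ?thesis
    by (simp add: landau_o.big.in_cong)
qed

lemma ord_zero:
  assumes "\<And>r. compensated_summation (u r) n x (\<eta> r) (\<sigma> r) (\<delta> r) (\<beta> r) (y r) (s r) (c r) \<Longrightarrow> f r = 0"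
  shows "f \<in> ord i"
  by (rule ord_transfer[where g = "\<lambda>r. 0" and j = i]) (simp_all add: assms)

lemma ord_roundoffs:
  assumes k: "k \<in> {2..n}"
  shows "(\<lambda>r. \<eta> r k) \<in> ord 1" "(\<lambda>r. \<sigma> r k) \<in> ord 1" "(\<lambda>r. \<delta> r k) \<in> ord 1" "(\<lambda>r. \<beta> r k) \<in> ord 1"
proof -
  have ord1: "f \<in> ord 1"
    if "\<And>r. compensated_summation (u r) n x (\<eta> r) (\<sigma> r) (\<delta> r) (\<beta> r) (y r) (s r) (c r) \<Longrightarrow> \<bar>f r\<bar> \<le> u r"
    for f :: "'r \<Rightarrow> real"
    using runs
    by (intro bigoI[where c = 1]) (auto elim!: eventually_mono dest!: that)
  show "(\<lambda>r. \<eta> r k) \<in> ord 1" by (rule ord1, erule run_roundoffs[OF _ k])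
  show "(\<lambda>r. \<sigma> r k) \<in> ord 1" by (rule ord1, erule run_roundoffs[OF _ k])
  show "(\<lambda>r. \<delta> r k) \<in> ord 1" by (rule ord1, erule run_roundoffs[OF _ k])
  show "(\<lambda>r. \<beta> r k) \<in> ord 1" by (rule ord1, erule run_roundoffs[OF _ k])
qed

abbreviation Def :: "nat \<Rightarrow> 'r \<Rightarrow> real" where
  "Def k r \<equiv> defect x (s r) (c r) k"

text \<open>
  The quantities in the recurrences at index \<open>k\<close> depend on the past only through \<open>c (k - 1)\<close> and
  the defect at \<open>k - 1\<close>.  Keeping these as hypotheses makes the estimates available inside the
  induction that establishes the hypotheses.
\<close>

lemma step_orders:
  assumes k: "k \<in> {2..n}" and c: "(\<lambda>r. c r (k - 1)) \<in> ord 1" and d: "Def (k - 1) \<in> ord 1"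
  shows "(\<lambda>r. x k - c r (k - 1)) \<in> ord 0"
    and "(\<lambda>r. y r k) \<in> ord 0"
    and "(\<lambda>r. s r (k - 1) + y r k - partial_sum x k) \<in> ord 1"
    and "(\<lambda>r. s r (k - 1) + y r k) \<in> ord 0"
proof -
  note e = ord_roundoffs[OF k]
  show z: "(\<lambda>r. x k - c r (k - 1)) \<in> ord 0"
    by (intro sum_in_bigo ord_const ord_mono[OF c]) simp
  have "(\<lambda>r. (x k - c r (k - 1)) * (1 + \<eta> r k)) \<in> ord (0 + 0)"
    by (intro ord_mult z sum_in_bigo ord_const ord_mono[OF e(1)]) simp
  then show "(\<lambda>r. y r k) \<in> ord 0"
    by (rule ord_transfer) (simp, erule run_step(1)[OF _ k])
  have "(\<lambda>r. Def (k - 1) r + \<eta> r k * (x k - c r (k - 1))) \<in> ord 1"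
    using ord_mult[OF e(1) z] by (intro sum_in_bigo(1) d) simp
  then show t: "(\<lambda>r. s r (k - 1) + y r k - partial_sum x k) \<in> ord 1"
    by (rule ord_transfer) (simp, drule pre_rounding_sum[OF _ k], simp)
  have "(\<lambda>r. (s r (k - 1) + y r k - partial_sum x k) + partial_sum x k) \<in> ord 0"
    by (intro sum_in_bigo ord_const ord_mono[OF t]) simp
  then show "(\<lambda>r. s r (k - 1) + y r k) \<in> ord 0" by simp
qed

lemma correction_defect_first_order:
  assumes "1 \<le> k" "k \<le> n"
  shows "(\<lambda>r. c r k) \<in> ord 1 \<and> Def k \<in> ord 1"
  using assms
proof (induction k rule: dec_induct)
  case base
  show ?case
    by (intro conjI; rule ord_zero)
      (auto simp: compensated_summation_def defect_def partial_sum_def)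
next
  case (step m)
  define k where "k = Suc m"
  have k: "k \<in> {2..n}" and m: "m = k - 1" using step by (auto simp: k_def)
  have c: "(\<lambda>r. c r (k - 1)) \<in> ord 1" and d: "Def (k - 1) \<in> ord 1"
    using step by (auto simp: m)
  note e = ord_roundoffs[OF k] and o = step_orders[OF k c d]
  have b: "(\<lambda>r. 1 + \<beta> r k) \<in> ord 0"
    by (intro sum_in_bigo ord_const ord_mono[OF e(4)]) simp
  have d1: "(\<lambda>r. 1 + \<delta> r k) \<in> ord 0"
    by (intro sum_in_bigo ord_const ord_mono[OF e(3)]) simp
  have db: "(\<lambda>r. \<delta> r k + \<beta> r k + \<delta> r k * \<beta> r k) \<in> ord 0"
    by (intro sum_in_bigo ord_mono[OF e(3)] ord_mono[OF e(4)] ord_mono[OF ord_mult[OF e(3,4)]]) simp_all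
  have st: "(\<lambda>r. \<sigma> r k * (s r (k - 1) + y r k)) \<in> ord 1"
    using ord_mult[OF e(2) o(4)] by simp
  have dy: "(\<lambda>r. \<delta> r k * y r k) \<in> ord 1"
    using ord_mult[OF e(3) o(2)] by simp
  have "(\<lambda>r. (\<sigma> r k * (s r (k - 1) + y r k) * (1 + \<delta> r k) + \<delta> r k * y r k) * (1 + \<beta> r k)) \<in> ord (1 + 0)"
    using ord_mult[OF st d1] by (intro ord_mult b sum_in_bigo dy) simp
  then have "(\<lambda>r. c r k) \<in> ord 1"
    by (rule ord_transfer) (simp, erule correction_eq[OF _ k])
  moreover
  have "(\<lambda>r. Def (k - 1) r + \<eta> r k * (x k - c r (k - 1))
     - \<sigma> r k * (s r (k - 1) + y r k) * (\<delta> r k + \<beta> r k + \<delta> r k * \<beta> r k)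
     - \<delta> r k * y r k * (1 + \<beta> r k)) \<in> ord 1"
    using ord_mult[OF e(1) o(1)] ord_mult[OF st db] ord_mult[OF dy b]
    by (intro sum_in_bigo d) simp_all
  then have "Def k \<in> ord 1"
    by (rule ord_transfer) (simp, erule defect_step[OF _ k])
  ultimately show ?case by (simp add: k_def)
qed

lemma correction_second_order:
  assumes "1 \<le> k" "k \<le> n"
  shows "(\<lambda>r. c r k - leading_correction x (\<sigma> r) (\<delta> r) k) \<in> ord 2"
proof (cases "k = 1")
  case True
  show ?thesis
    by (rule ord_zero) (simp add: compensated_summation_def leading_correction_def True)
next
  case False
  with assms have k: "k \<in> {2..n}" by auto
  then have "(\<lambda>r. c r (k - 1)) \<in> ord 1 \<and> Def (k - 1) \<in> ord 1"
    by (intro correction_defect_first_order) auto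
  then have c: "(\<lambda>r. c r (k - 1)) \<in> ord 1" and d: "Def (k - 1) \<in> ord 1" by auto
  note e = ord_roundoffs[OF k] and o = step_orders[OF k c d]
  have "(\<lambda>r. \<sigma> r k * (s r (k - 1) + y r k - partial_sum x k)) \<in> ord (1 + 1)"
    by (intro ord_mult e o)
  moreover have "(\<lambda>r. \<sigma> r k * (s r (k - 1) + y r k) * (\<delta> r k + \<beta> r k + \<delta> r k * \<beta> r k))
      \<in> ord ((1 + 0) + 1)"
    using ord_mono[OF ord_mult[OF e(3,4)], of 1] by (intro ord_mult e o sum_in_bigo) simp
  moreover have "(\<lambda>r. \<delta> r k * ((x k - c r (k - 1)) * \<eta> r k - c r (k - 1))) \<in> ord (1 + 1)"
    using ord_mult[OF o(1) e(1)] by (intro ord_mult e c sum_in_bigo) simp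
  moreover have "(\<lambda>r. \<delta> r k * y r k * \<beta> r k) \<in> ord ((1 + 0) + 1)"
    by (intro ord_mult e o)
  ultimately have "(\<lambda>r. \<sigma> r k * (s r (k - 1) + y r k - partial_sum x k)
     + \<sigma> r k * (s r (k - 1) + y r k) * (\<delta> r k + \<beta> r k + \<delta> r k * \<beta> r k)
     + \<delta> r k * ((x k - c r (k - 1)) * \<eta> r k - c r (k - 1)) + \<delta> r k * y r k * \<beta> r k) \<in> ord 2"
    by (intro sum_in_bigo) (simp_all add: numeral_2_eq_2)
  then show ?thesis
    by (rule ord_transfer) (simp, erule correction_remainder[OF _ k])
qed

lemma defect_increment_third_order:
  assumes k: "k \<in> {2..n}"
  shows "(\<lambda>r. Def k r - Def (k - 1) r - leading_increment x (\<eta> r) (\<sigma> r) (\<delta> r) (\<beta> r) k) \<in> ord 3"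
proof -
  have "(\<lambda>r. c r (k - 1)) \<in> ord 1 \<and> Def (k - 1) \<in> ord 1"
    using k by (intro correction_defect_first_order) auto
  then have c: "(\<lambda>r. c r (k - 1)) \<in> ord 1" and d: "Def (k - 1) \<in> ord 1" by auto
  have c2: "(\<lambda>r. c r (k - 1) - leading_correction x (\<sigma> r) (\<delta> r) (k - 1)) \<in> ord 2"
    using k by (intro correction_second_order) auto
  note e = ord_roundoffs[OF k] and o = step_orders[OF k c d]
  have "(\<lambda>r. \<delta> r k * c r (k - 1) * (\<eta> r k + \<beta> r k)) \<in> ord ((1 + 1) + 1)"
    by (intro ord_mult e c sum_in_bigo)
  moreover have "(\<lambda>r. (\<eta> r k - \<delta> r k) * (c r (k - 1) - leading_correction x (\<sigma> r) (\<delta> r) (k - 1)))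
      \<in> ord (1 + 2)"
    by (intro ord_mult e c2 sum_in_bigo)
  moreover have "(\<lambda>r. \<delta> r k * (x k - c r (k - 1)) * (\<eta> r k * \<beta> r k)) \<in> ord ((1 + 0) + (1 + 1))"
    by (intro ord_mult e o)
  moreover have "(\<lambda>r. \<sigma> r k * (s r (k - 1) + y r k - partial_sum x k) * (\<delta> r k + \<beta> r k))
      \<in> ord ((1 + 1) + 1)"
    by (intro ord_mult e o sum_in_bigo)
  moreover have "(\<lambda>r. \<sigma> r k * (s r (k - 1) + y r k) * (\<delta> r k * \<beta> r k)) \<in> ord ((1 + 0) + (1 + 1))"
    by (intro ord_mult e o)
  ultimately have "(\<lambda>r. \<delta> r k * c r (k - 1) * (\<eta> r k + \<beta> r k)
     - (\<eta> r k - \<delta> r k) * (c r (k - 1) - leading_correction x (\<sigma> r) (\<delta> r) (k - 1))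
     - \<delta> r k * (x k - c r (k - 1)) * (\<eta> r k * \<beta> r k)
     - \<sigma> r k * (s r (k - 1) + y r k - partial_sum x k) * (\<delta> r k + \<beta> r k)
     - \<sigma> r k * (s r (k - 1) + y r k) * (\<delta> r k * \<beta> r k)) \<in> ord 3"
    by (intro sum_in_bigo) (simp_all add: eval_nat_numeral)
  then show ?thesis
    by (rule ord_transfer) (simp, erule defect_increment_remainder[OF _ k])
qed

lemma defect_third_order:
  assumes "1 \<le> k" "k \<le> n"
  shows "(\<lambda>r. Def k r - (\<Sum>j=2..k. leading_increment x (\<eta> r) (\<sigma> r) (\<delta> r) (\<beta> r) j)) \<in> ord 3"
  using assms
proof (induction k rule: dec_induct)
  case base
  show ?case
    by (rule ord_zero) (simp add: compensated_summation_def defect_def partial_sum_def)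
next
  case (step k)
  let ?l = "\<lambda>r. leading_increment x (\<eta> r) (\<sigma> r) (\<delta> r) (\<beta> r)"
  have "(\<lambda>r. (Def k r - (\<Sum>j=2..k. ?l r j)) + (Def (Suc k) r - Def (Suc k - 1) r - ?l r (Suc k))) \<in> ord 3"
    using step by (intro sum_in_bigo(1) defect_increment_third_order) auto
  then show ?case
    by (rule ord_transfer) (use step.hyps in simp_all)
qed

end

section \<open>The expansion and the bound\<close>

definition second_order_terms ::
  "nat \<Rightarrow> (nat \<Rightarrow> real) \<Rightarrow> (nat \<Rightarrow> real) \<Rightarrow> (nat \<Rightarrow> real) \<Rightarrow> (nat \<Rightarrow> real) \<Rightarrow> (nat \<Rightarrow> real) \<Rightarrow> real" where
  "second_order_terms n x \<eta> \<sigma> \<delta> \<beta> =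
     (\<Sum>k=2..n-1. partial_sum x k * \<sigma> k * (mu n \<eta> \<delta> (k+1) + \<delta> k + \<beta> k))
     + (\<Sum>k=2..n-1. x k * \<delta> k * (mu n \<eta> \<delta> (k+1) + \<beta> k + \<eta> k))"

text \<open>
  Each leading correction \<open>c (k - 1)\<close> is multiplied by \<open>\<mu>\<^sub>k\<close>; after the shift \<open>k \<mapsto> k + 1\<close> it
  joins the other terms with \<open>\<sigma>\<^sub>k s\<^sub>k\<close> and \<open>\<delta>\<^sub>k x\<^sub>k\<close>, which explains the index in \<open>\<mu>\<^bsub>k+1\<^esub>\<close>.
\<close>

lemma sum_leading_increments:
  assumes "n \<ge> 2"
  shows "(\<Sum>k=2..n-1. leading_increment x \<eta> \<sigma> \<delta> \<beta> k)
      + \<eta> n * (x n - leading_correction x \<sigma> \<delta> (n - 1))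
    = (\<Sum>k=2..n. x k * mu n \<eta> \<delta> k) - second_order_terms n x \<eta> \<sigma> \<delta> \<beta>"
proof -
  obtain m where n: "n = Suc m" and m: "m \<ge> 1" using assms by (cases n) auto
  let ?L = "leading_correction x \<sigma> \<delta>" and ?\<mu> = "mu n \<eta> \<delta>"
  let ?q = "\<lambda>k. \<sigma> k * partial_sum x k * (\<delta> k + \<beta> k) + \<delta> k * x k * (\<eta> k + \<beta> k)"
  have "(\<Sum>k=2..m. leading_increment x \<eta> \<sigma> \<delta> \<beta> k) + \<eta> n * (x n - ?L (n - 1))
      = (\<Sum>k=2..m. (x k - ?L (k - 1)) * ?\<mu> k - ?q k) + (x n - ?L (n - 1)) * ?\<mu> n"
    by (auto intro!: sum.cong simp: leading_increment_def mu_def n)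
  also have "\<dots> = (\<Sum>k=2..n. (x k - ?L (k - 1)) * ?\<mu> k) - (\<Sum>k=2..m. ?q k)"
    using m by (simp add: n sum_subtractf)
  also have "\<dots> = (\<Sum>k=2..n. x k * ?\<mu> k) - ((\<Sum>k=2..n. ?L (k - 1) * ?\<mu> k) + (\<Sum>k=2..m. ?q k))"
    by (simp add: left_diff_distrib sum_subtractf)
  also have "(\<Sum>k=2..n. ?L (k - 1) * ?\<mu> k) = (\<Sum>k=1..m. ?L k * ?\<mu> (k + 1))"
    using sum.shift_bounds_cl_Suc_ivl[of "\<lambda>k. ?L (k - 1) * ?\<mu> k" 1 m] by (simp add: n numeral_2_eq_2)
  \<comment> \<open>The term at \<open>k = 1\<close> drops out because \<open>c 1 = 0\<close>.\<close>
  also have "\<dots> = (\<Sum>k=2..m. ?L k * ?\<mu> (k + 1))"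
    using m by (simp add: sum.atLeast_Suc_atMost leading_correction_def numeral_2_eq_2)
  also have "\<dots> + (\<Sum>k=2..m. ?q k) = second_order_terms n x \<eta> \<sigma> \<delta> \<beta>"
    unfolding second_order_terms_def sum.distrib[symmetric]
    by (auto intro!: sum.cong simp: n leading_correction_def algebra_simps)
  finally show ?thesis by (simp add: n)
qed

definition error_expansion ::
  "nat \<Rightarrow> (nat \<Rightarrow> real) \<Rightarrow> (nat \<Rightarrow> real) \<Rightarrow> (nat \<Rightarrow> real) \<Rightarrow> (nat \<Rightarrow> real) \<Rightarrow> (nat \<Rightarrow> real) \<Rightarrow> real" where
  "error_expansion n x \<eta> \<sigma> \<delta> \<beta> =
     partial_sum x n * \<sigma> n + (1 + \<sigma> n) * (\<Sum>k=2..n. x k * mu n \<eta> \<delta> k)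
     - (\<Sum>k=2..n-1. partial_sum x k * \<sigma> k * (mu n \<eta> \<delta> (k+1) + \<delta> k + \<beta> k))
     - (\<Sum>k=2..n-1. x k * \<delta> k * (mu n \<eta> \<delta> (k+1) + \<beta> k + \<eta> k))"

context compensated_summation_family
begin

lemma ord_mu:
  assumes "k \<in> {2..n}"
  shows "(\<lambda>r. mu n (\<eta> r) (\<delta> r) k) \<in> ord 1"
  using ord_roundoffs[OF assms] by (cases "k = n") (simp_all add: mu_def sum_in_bigo)

lemma second_order_terms_ord:
  "(\<lambda>r. second_order_terms n x (\<eta> r) (\<sigma> r) (\<delta> r) (\<beta> r)) \<in> ord 2"
proof -
  have "(\<lambda>r. partial_sum x k * \<sigma> r k * (mu n (\<eta> r) (\<delta> r) (k+1) + \<delta> r k + \<beta> r k)) \<in> ord (0 + 1 + 1)"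
    "(\<lambda>r. x k * \<delta> r k * (mu n (\<eta> r) (\<delta> r) (k+1) + \<beta> r k + \<eta> r k)) \<in> ord (0 + 1 + 1)"
    if "k \<in> {2..n-1}" for k
    using that by (intro ord_mult ord_const sum_in_bigo ord_mu ord_roundoffs; force)+
  then show ?thesis
    unfolding second_order_terms_def
    by (intro sum_in_bigo big_sum_in_bigo) (simp_all add: numeral_2_eq_2)
qed

text \<open>
  The last step is \<open>s n = (1 + \<sigma>\<^sub>n) (s\<^sub>n + \<dots>)\<close>; the factor \<open>1 + \<sigma>\<^sub>n\<close> is dropped in front of the
  second-order terms only.
\<close>

lemma error_expansion_third_order:
  assumes "n \<ge> 2"
  shows "(\<lambda>r. s r n - partial_sum x n - error_expansion n x (\<eta> r) (\<sigma> r) (\<delta> r) (\<beta> r)) \<in> ord 3"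
proof -
  have n: "n \<in> {2..n}" using assms by simp
  let ?L = "\<lambda>r. leading_correction x (\<sigma> r) (\<delta> r) (n - 1)"
  let ?I = "\<lambda>r. \<Sum>k=2..n-1. leading_increment x (\<eta> r) (\<sigma> r) (\<delta> r) (\<beta> r) k"
  let ?Q = "\<lambda>r. second_order_terms n x (\<eta> r) (\<sigma> r) (\<delta> r) (\<beta> r)"
  note e = ord_roundoffs[OF n]
  have d: "(\<lambda>r. Def (n - 1) r - ?I r) \<in> ord 3"
    using assms by (intro defect_third_order) auto
  have c: "(\<lambda>r. c r (n - 1) - ?L r) \<in> ord 2"
    using assms by (intro correction_second_order) auto
  have sg: "(\<lambda>r. 1 + \<sigma> r n) \<in> ord 0"
    by (intro sum_in_bigo ord_const ord_mono[OF e(2)]) simp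
  have ec: "(\<lambda>r. \<eta> r n * (c r (n - 1) - ?L r)) \<in> ord 3"
    using ord_mult[OF e(1) c] by (rule ord_mono) simp
  have "(\<lambda>r. (1 + \<sigma> r n) * ((Def (n - 1) r - ?I r) - \<eta> r n * (c r (n - 1) - ?L r)) - \<sigma> r n * ?Q r) \<in> ord 3"
  proof (rule sum_in_bigo(2))
    show "(\<lambda>r. (1 + \<sigma> r n) * ((Def (n - 1) r - ?I r) - \<eta> r n * (c r (n - 1) - ?L r))) \<in> ord 3"
      using ord_mult[OF sg sum_in_bigo(2)[OF d ec]] by simp
    show "(\<lambda>r. \<sigma> r n * ?Q r) \<in> ord 3"
      using ord_mult[OF e(2) second_order_terms_ord] by (rule ord_mono) simp
  qed
  then show ?thesis
  proof (rule ord_transfer)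
    fix r
    assume run: "compensated_summation (u r) n x (\<eta> r) (\<sigma> r) (\<delta> r) (\<beta> r) (y r) (s r) (c r)"
    let ?M = "\<Sum>k=2..n. x k * mu n (\<eta> r) (\<delta> r) k"
    have E: "error_expansion n x (\<eta> r) (\<sigma> r) (\<delta> r) (\<beta> r)
        = partial_sum x n * \<sigma> r n + (1 + \<sigma> r n) * ?M - ?Q r"
      by (simp add: error_expansion_def second_order_terms_def)
    have M: "?M = ?I r + \<eta> r n * (x n - ?L r) + ?Q r"
      using sum_leading_increments[OF assms, of x "\<eta> r" "\<sigma> r" "\<delta> r" "\<beta> r"] by linarith
    show "s r n - partial_sum x n - error_expansion n x (\<eta> r) (\<sigma> r) (\<delta> r) (\<beta> r)
      = (1 + \<sigma> r n) * ((Def (n - 1) r - ?I r) - \<eta> r n * (c r (n - 1) - ?L r)) - \<sigma> r n * ?Q r"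
      unfolding final_sum[OF run n] E M by (simp add: algebra_simps)
  qed simp
qed

end

lemma abs_partial_sum_le:
  assumes "k \<le> n"
  shows "\<bar>partial_sum x k\<bar> \<le> (\<Sum>j=1..n. \<bar>x j\<bar>)"
proof -
  have "\<bar>partial_sum x k\<bar> \<le> (\<Sum>j=1..k. \<bar>x j\<bar>)"
    unfolding partial_sum_def by (rule sum_abs)
  also have "\<dots> \<le> (\<Sum>j=1..n. \<bar>x j\<bar>)"
    using assms by (intro sum_mono2) auto
  finally show ?thesis .
qed

lemma abs_weighted_sum_le:
  fixes x w :: "nat \<Rightarrow> real"
  assumes w: "\<And>k. k \<in> {2..m} \<Longrightarrow> \<bar>w k\<bar> \<le> b" and "m \<le> n" "0 \<le> b"
  shows "\<bar>\<Sum>k=2..m. x k * w k\<bar> \<le> b * (\<Sum>k=1..n. \<bar>x k\<bar>)"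
proof -
  have "\<bar>\<Sum>k=2..m. x k * w k\<bar> \<le> (\<Sum>k=2..m. \<bar>x k\<bar> * b)"
    by (rule order_trans[OF sum_abs]) (auto intro!: sum_mono mult_left_mono w simp: abs_mult)
  also have "\<dots> \<le> (\<Sum>k=1..n. \<bar>x k\<bar> * b)"
    using assms by (intro sum_mono2) auto
  also have "\<dots> = b * (\<Sum>k=1..n. \<bar>x k\<bar>)"
    by (simp add: sum_distrib_left mult.commute)
  finally show ?thesis .
qed

lemma error_expansion_bound:
  fixes x :: "nat \<Rightarrow> real" and u :: real
  assumes "n \<ge> 2" and run: "compensated_summation u n x \<eta> \<sigma> \<delta> \<beta> y s c"
  shows "\<bar>error_expansion n x \<eta> \<sigma> \<delta> \<beta>\<bar> \<le> (3 * u + 4 * real n * u ^ 2) * (\<Sum>k=1..n. \<bar>x k\<bar>)"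
proof -
  let ?S = "\<Sum>k=1..n. \<bar>x k\<bar>" and ?\<mu> = "mu n \<eta> \<delta>"
  have u: "0 < u" using run by (simp add: compensated_summation_def)
  have S: "0 \<le> ?S" by (simp add: sum_nonneg)
  note e = run_roundoffs[OF run]
  have \<mu>: "\<bar>?\<mu> k\<bar> \<le> 2 * u" if "k \<in> {2..n}" for k
    using e[OF that] u by (auto simp: mu_def)
  have \<sigma>: "\<bar>\<sigma> n\<bar> \<le> u" using e(2)[of n] assms by simp
  have small: "\<bar>a * b\<bar> \<le> 4 * u\<^sup>2" if "\<bar>a\<bar> \<le> u" "\<bar>b\<bar> \<le> 4 * u" for a b
    using mult_mono[OF that] u by (simp add: abs_mult power2_eq_square)
  have "\<bar>partial_sum x n * \<sigma> n\<bar> \<le> ?S * u"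
    unfolding abs_mult by (intro mult_mono abs_partial_sum_le \<sigma> S) simp_all
  moreover have "\<bar>(1 + \<sigma> n) * (\<Sum>k=2..n. x k * ?\<mu> k)\<bar> \<le> (1 + u) * (2 * u * ?S)"
    unfolding abs_mult using \<sigma> u by (intro mult_mono abs_weighted_sum_le \<mu>) auto
  moreover have "\<bar>\<Sum>k=2..n-1. partial_sum x k * \<sigma> k * (?\<mu> (k+1) + \<delta> k + \<beta> k)\<bar>
      \<le> (real n - 2) * (4 * u\<^sup>2 * ?S)"
  proof -
    have "\<bar>partial_sum x k * \<sigma> k * (?\<mu> (k+1) + \<delta> k + \<beta> k)\<bar> \<le> 4 * u\<^sup>2 * ?S" if "k \<in> {2..n-1}" for k
    proof -
      have k: "k \<in> {2..n}" "k + 1 \<in> {2..n}" using that by auto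
      have "\<bar>\<sigma> k * (?\<mu> (k+1) + \<delta> k + \<beta> k)\<bar> \<le> 4 * u\<^sup>2"
        using e[OF k(1)] \<mu>[OF k(2)] by (intro small) linarith+
      moreover have "\<bar>partial_sum x k\<bar> \<le> ?S" using k by (intro abs_partial_sum_le) auto
      ultimately have "\<bar>partial_sum x k\<bar> * \<bar>\<sigma> k * (?\<mu> (k+1) + \<delta> k + \<beta> k)\<bar> \<le> ?S * (4 * u\<^sup>2)"
        by (intro mult_mono S) simp_all
      then show ?thesis by (simp add: abs_mult mult_ac)
    qed
    then have "(\<Sum>k=2..n-1. \<bar>partial_sum x k * \<sigma> k * (?\<mu> (k+1) + \<delta> k + \<beta> k)\<bar>)
        \<le> of_nat (card {2..n-1}) * (4 * u\<^sup>2 * ?S)"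
      by (rule sum_bounded_above)
    then show ?thesis
      using assms(1) by (intro order_trans[OF sum_abs]) (simp add: of_nat_diff)
  qed
  moreover have "\<bar>\<Sum>k=2..n-1. x k * \<delta> k * (?\<mu> (k+1) + \<beta> k + \<eta> k)\<bar> \<le> 4 * u\<^sup>2 * ?S"
  proof -
    have "\<bar>\<delta> k * (?\<mu> (k+1) + \<beta> k + \<eta> k)\<bar> \<le> 4 * u\<^sup>2" if "k \<in> {2..n-1}" for k
    proof -
      have k: "k \<in> {2..n}" "k + 1 \<in> {2..n}" using that by auto
      show ?thesis using e[OF k(1)] \<mu>[OF k(2)] by (intro small) linarith+
    qed
    from abs_weighted_sum_le[OF this, where n = n and x = x] show ?thesis by (simp add: mult.assoc)
  qed
  ultimately have "\<bar>error_expansion n x \<eta> \<sigma> \<delta> \<beta>\<bar>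
      \<le> ?S * u + (1 + u) * (2 * u * ?S) + (real n - 2) * (4 * u\<^sup>2 * ?S) + 4 * u\<^sup>2 * ?S"
    unfolding error_expansion_def by linarith
  also have "\<dots> = (3 * u + 4 * real n * u\<^sup>2) * ?S - 2 * (u\<^sup>2 * ?S)"
    by (simp add: algebra_simps power2_eq_square)
  also have "\<dots> \<le> (3 * u + 4 * real n * u\<^sup>2) * ?S"
    using S by simp
  finally show ?thesis .
qed

text \<open>
  Here the family of all runs is formed: its index type consists of tuples
  \<open>(u, \<eta>, \<sigma>, \<delta>, \<beta>, y, s, c)\<close>, and its filter restricts the preimage of \<open>u \<rightarrow> 0\<close> to the
  admissible tuples.
\<close>

lemma uniform_error_expansion:
  assumes "n \<ge> 2"
  shows "\<exists>C>0. \<forall>\<^sub>F u in at_right (0::real). \<forall>\<eta> \<sigma> \<delta> \<beta> y s c.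
    compensated_summation u n x \<eta> \<sigma> \<delta> \<beta> y s c \<longrightarrow>
    \<bar>s n - partial_sum x n - error_expansion n x \<eta> \<sigma> \<delta> \<beta>\<bar> \<le> C * u ^ 3"
proof -
  let ?A = "{(u, \<eta>, \<sigma>, \<delta>, \<beta>, y, s, c). compensated_summation u n x \<eta> \<sigma> \<delta> \<beta> y s c}"
  define F where "F = inf (filtercomap fst (at_right 0)) (principal ?A)"
  interpret compensated_summation_family F n x
    "\<lambda>(u, \<eta>, \<sigma>, \<delta>, \<beta>, y, s, c). u" "\<lambda>(u, \<eta>, \<sigma>, \<delta>, \<beta>, y, s, c). \<eta>"
    "\<lambda>(u, \<eta>, \<sigma>, \<delta>, \<beta>, y, s, c). \<sigma>" "\<lambda>(u, \<eta>, \<sigma>, \<delta>, \<beta>, y, s, c). \<delta>"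
    "\<lambda>(u, \<eta>, \<sigma>, \<delta>, \<beta>, y, s, c). \<beta>" "\<lambda>(u, \<eta>, \<sigma>, \<delta>, \<beta>, y, s, c). y"
    "\<lambda>(u, \<eta>, \<sigma>, \<delta>, \<beta>, y, s, c). s" "\<lambda>(u, \<eta>, \<sigma>, \<delta>, \<beta>, y, s, c). c"
    by unfold_locales (simp add: F_def eventually_inf_principal case_prod_unfold)
  from error_expansion_third_order[OF assms] obtain C where C: "C > 0"
    and "\<forall>\<^sub>F (u, \<eta>, \<sigma>, \<delta>, \<beta>, y, s, c) in F.
      \<bar>s n - partial_sum x n - error_expansion n x \<eta> \<sigma> \<delta> \<beta>\<bar> \<le> C * \<bar>u ^ 3\<bar>"
    by (elim landau_o.bigE) (auto simp: case_prod_unfold)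
  then obtain P where P: "\<forall>\<^sub>F u in at_right 0. P u"
    and bound: "\<And>u \<eta> \<sigma> \<delta> \<beta> y s c. P u \<Longrightarrow> compensated_summation u n x \<eta> \<sigma> \<delta> \<beta> y s c \<Longrightarrow>
      \<bar>s n - partial_sum x n - error_expansion n x \<eta> \<sigma> \<delta> \<beta>\<bar> \<le> C * \<bar>u ^ 3\<bar>"
    unfolding F_def eventually_inf_principal eventually_filtercomap by fastforce
  have "\<forall>\<^sub>F u in at_right (0::real). \<forall>\<eta> \<sigma> \<delta> \<beta> y s c.
      compensated_summation u n x \<eta> \<sigma> \<delta> \<beta> y s c \<longrightarrow>
      \<bar>s n - partial_sum x n - error_expansion n x \<eta> \<sigma> \<delta> \<beta>\<bar> \<le> C * u ^ 3"
    using P eventually_at_right_less[of "0::real"]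
  proof eventually_elim
    case (elim u)
    then show ?case using bound[of u] by simp
  qed
  with C show ?thesis by blast
qed

theorem theorem4p5:
  fixes x :: "nat \<Rightarrow> real" and n :: nat
  assumes "n \<ge> 2"
  shows "(\<exists>C>0. \<forall>\<^sub>F u in at_right (0::real). \<forall>\<eta> \<sigma> \<delta> \<beta> y s c.
           compensated_summation u n x \<eta> \<sigma> \<delta> \<beta> y s c \<longrightarrow>
           \<bar>(s n - partial_sum x n) -
             (partial_sum x n * \<sigma> n
              + (1 + \<sigma> n) * (\<Sum>k=2..n. x k * mu n \<eta> \<delta> k)
              - (\<Sum>k=2..n-1. partial_sum x k * \<sigma> k * (mu n \<eta> \<delta> (k+1) + \<delta> k + \<beta> k))
              - (\<Sum>k=2..n-1. x k * \<delta> k * (mu n \<eta> \<delta> (k+1) + \<beta> k + \<eta> k)))\<bar>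
           \<le> C * u ^ 3) \<and>
         (\<exists>C>0. \<forall>\<^sub>F u in at_right (0::real). \<forall>\<eta> \<sigma> \<delta> \<beta> y s c.
           compensated_summation u n x \<eta> \<sigma> \<delta> \<beta> y s c \<longrightarrow>
           \<bar>s n - partial_sum x n\<bar>
           \<le> (3 * u + 4 * real n * u ^ 2) * (\<Sum>k=1..n. \<bar>x k\<bar>) + C * u ^ 3)"
proof -
  obtain C where C: "C > 0" and ev: "\<forall>\<^sub>F u in at_right (0::real). \<forall>\<eta> \<sigma> \<delta> \<beta> y s c.
      compensated_summation u n x \<eta> \<sigma> \<delta> \<beta> y s c \<longrightarrow>
      \<bar>s n - partial_sum x n - error_expansion n x \<eta> \<sigma> \<delta> \<beta>\<bar> \<le> C * u ^ 3"
    using uniform_error_expansion[OF assms] by blast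
  have "\<forall>\<^sub>F u in at_right (0::real). \<forall>\<eta> \<sigma> \<delta> \<beta> y s c.
      compensated_summation u n x \<eta> \<sigma> \<delta> \<beta> y s c \<longrightarrow>
      \<bar>s n - partial_sum x n\<bar> \<le> (3 * u + 4 * real n * u ^ 2) * (\<Sum>k=1..n. \<bar>x k\<bar>) + C * u ^ 3"
    using ev
  proof (rule eventually_mono, intro allI impI)
    fix u \<eta> \<sigma> \<delta> \<beta> y s c
    assume "\<forall>\<eta> \<sigma> \<delta> \<beta> y s c. compensated_summation u n x \<eta> \<sigma> \<delta> \<beta> y s c \<longrightarrow>
        \<bar>s n - partial_sum x n - error_expansion n x \<eta> \<sigma> \<delta> \<beta>\<bar> \<le> C * u ^ 3"
      and run: "compensated_summation u n x \<eta> \<sigma> \<delta> \<beta> y s c"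
    then have "\<bar>s n - partial_sum x n - error_expansion n x \<eta> \<sigma> \<delta> \<beta>\<bar> \<le> C * u ^ 3"
      by blast
    with error_expansion_bound[OF assms run]
    show "\<bar>s n - partial_sum x n\<bar> \<le> (3 * u + 4 * real n * u ^ 2) * (\<Sum>k=1..n. \<bar>x k\<bar>) + C * u ^ 3"
      by linarith
  qed
  with C ev show ?thesis
    unfolding error_expansion_def by blast
qed

end
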